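(* Let $k$ be a field of characteristic different from $2$ and let $H=(kC_2)^*$. Let $A$ be a partially $\mathbb Z_2$-graded algebra and let $A=A_0\oplus A_1\oplus A_{1/2}$ be its decomposition as an $H_{par}$-module. Then: 1. $B=A_0\oplus A_1$ is a subalgebra of $A$ which is $\mathbb Z_2$-graded by $B_{\overline 0}=A_0$ and $B_{\overline 1}=A_1$. 2. $A_{1/2}$ is an ideal of $A$. 3. The unit of $A$ decomposes as $1_A=u+v$ where $u,v$ are orthogonal idempotents, $u\in A_0$ and $v\in A_{1/2}$. 4. $uAv=vAu=0$, and therefore $A\simeq B\times A_{1/2}$ as an algebra.
   Context: $C_2=\{e,g\}$ is the cyclic group of order $2$ with identity $e$. $(kC_2)^*$ is the dual group Hopf algebra, with basis $p_e,p_g$ where $p_x(y)=\delta_{x,y}$; thus $1=p_e+p_g$, $p_ep_g=0$, and $\Delta(p_x)=\sum_{l}p_{xl^{-1}}\otimes p_l$. A partially $\mathbb Z_2$-graded algebra is a unital $k$-algebra $A$ with a symmetric partial action of $(kC_2)^*$, i.e. with linear operators $p_x\cdot-$ on $A$ ($x\in C_2$) such that for all $a,b\in A$ and $x,y\in C_2$: $\sum_xp_x\cdot a=a$; $p_x\cdot(ab)=\sum_{l\in C_2}(p_{xl^{-1}}\cdot a)(p_l\cdot b)$; $p_x\cdot(p_y\cdot a)=(p_{xy^{-1}}\cdot1_A)(p_y\cdot a)=(p_y\cdot a)(p_{y^{-1}x}\cdot1_A)$. The universal algebra $H_{par}$ factoring partial representations of $H$ is here isomorphic to $k[x]/\langle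 x(2x-1)(x-1)\rangle$ with the class $[p_g]$ corresponding to $x$, and $A$ is a module over it with $x$ acting by $p_g\cdot-$. The decomposition $A=A_0\oplus A_1\oplus A_{1/2}$ is the eigenspace decomposition: $A_j=\{a\in A:\ p_g\cdot a=ja\}$ for $j\in\{0,1,1/2\}$. "Subalgebra" in item 1 means a linear subspace closed under multiplication (its unit need not be $1_A$). *)

theory Defs
  imports "HOL-Analysis.Product_Vector" "HOL-Library.FuncSet" "HOL-Library.Z2"
begin

text \<open>
  The sort \<open>{ring, monoid_mult}\<close> is used instead of \<open>ring_1\<close> because the latter
  includes \<open>0 \<noteq> 1\<close>, which would exclude the zero algebra.
\<close>

locale unital_algebra = vector_space sc
  for sc :: "'k::field \<Rightarrow> 'a::{ring, monoid_mult} \<Rightarrow> 'a" +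
  assumes scale_mult_left: "sc c (a * b) = sc c a * b"
    and scale_mult_right: "sc c (a * b) = a * sc c b"

text \<open>
  A symmetric partial action of the Hopf algebra \<open>(kG)\<^sup>*\<close>, for a finite group \<open>G\<close>, given by the
  operators \<open>p x = (p\<^sub>x \<cdot> -)\<close> of the dual basis. The group is written additively, so
  \<open>x - l\<close> is \<open>x l\<^sup>-\<^sup>1\<close> and \<open>- y + x\<close> is \<open>y\<^sup>-\<^sup>1 x\<close>.
\<close>

locale partially_graded_algebra = unital_algebra sc
  for sc :: "'k::field \<Rightarrow> 'a::{ring, monoid_mult} \<Rightarrow> 'a" +
  fixes p :: "'g::{finite, group_add} \<Rightarrow> 'a \<Rightarrow> 'a"
  assumes p_linear: "Vector_Spaces.linear sc sc (p x)"
    and p_sum: "(\<Sum>x\<in>UNIV. p x a) = a"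
    and p_mult: "p x (a * b) = (\<Sum>l\<in>UNIV. p (x - l) a * p l b)"
    and p_p_left: "p x (p y a) = p (x - y) 1 * p y a"
    and p_p_right: "p x (p y a) = p y a * p (- y + x) 1"

text \<open>
  The group \<open>C\<^sub>2 = {e, g}\<close> is the additive group of \<^typ>\<open>bit\<close>, with \<open>e = 0\<close> and \<open>g = 1\<close>.
\<close>

instance bit :: finite
proof
  have "(UNIV :: bit set) = {0, 1}"
    by auto
  then show "finite (UNIV :: bit set)"
    by (metis finite.emptyI finite.insertI)
qed

text \<open>
  The eigenspace \<open>A\<^sub>j\<close> of \<open>p\<^sub>g \<cdot> -\<close>.
\<close>

definition component ::
  "('k::field \<Rightarrow> 'a::{ring, monoid_mult} \<Rightarrow> 'a) \<Rightarrow> (bit \<Rightarrow> 'a \<Rightarrow> 'a) \<Rightarrow> 'k \<Rightarrow> 'a set"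
  where "component sc p j = {a. p 1 a = sc j a}"

definition sum_of_subspaces :: "'a::ab_group_add set \<Rightarrow> 'a set \<Rightarrow> 'a set"
  where "sum_of_subspaces U V = {x + y |x y. x \<in> U \<and> y \<in> V}"

definition internal_direct_sum ::
  "('k::field \<Rightarrow> 'a::ab_group_add \<Rightarrow> 'a) \<Rightarrow> 'i set \<Rightarrow> ('i \<Rightarrow> 'a set) \<Rightarrow> 'a set \<Rightarrow> bool"
  where "internal_direct_sum sc I V S \<longleftrightarrow>
    (\<forall>i\<in>I. module.subspace sc (V i)) \<and>
    bij_betw (\<lambda>f. \<Sum>i\<in>I. f i) (Pi\<^sub>E I V) S"

text \<open>
  A subalgebra need not contain the unit of the ambient algebra.
\<close>

definition subalgebra :: "('k::field \<Rightarrow> 'a::ring \<Rightarrow> 'a) \<Rightarrow> 'a set \<Rightarrow> bool"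
  where "subalgebra sc S \<longleftrightarrow>
    module.subspace sc S \<and> (\<forall>a\<in>S. \<forall>b\<in>S. a * b \<in> S)"

definition algebra_ideal :: "('k::field \<Rightarrow> 'a::ring \<Rightarrow> 'a) \<Rightarrow> 'a set \<Rightarrow> bool"
  where "algebra_ideal sc I \<longleftrightarrow>
    module.subspace sc I \<and> (\<forall>a. \<forall>b\<in>I. a * b \<in> I \<and> b * a \<in> I)"

definition graded_by ::
  "('k::field \<Rightarrow> 'a::ring \<Rightarrow> 'a) \<Rightarrow> 'a set \<Rightarrow> ('g::{finite, group_add} \<Rightarrow> 'a set) \<Rightarrow> bool"
  where "graded_by sc S V \<longleftrightarrow>
    internal_direct_sum sc UNIV V S \<and>
    (\<forall>x y. \<forall>a\<in>V x. \<forall>b\<in>V y. a * b \<in> V (x + y))"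

definition is_unit_of :: "'a::ring \<Rightarrow> 'a set \<Rightarrow> bool"
  where "is_unit_of w S \<longleftrightarrow> w \<in> S \<and> (\<forall>a\<in>S. w * a = a \<and> a * w = a)"

text \<open>
  \<open>\<phi>\<close> is an isomorphism of unital algebras from the ambient algebra onto the product of the
  subalgebras \<open>S\<close> and \<open>T\<close>, whose own units are \<open>u\<close> and \<open>v\<close>. Addition and scalar
  multiplication on pairs are the componentwise ones of the library; the library has no
  multiplication on pairs.
\<close>

definition algebra_iso_onto_product ::
  "('k::field \<Rightarrow> 'a::{ring, monoid_mult} \<Rightarrow> 'a) \<Rightarrow> ('a \<Rightarrow> 'a \<times> 'a) \<Rightarrow>
    'a set \<Rightarrow> 'a \<Rightarrow> 'a set \<Rightarrow> 'a \<Rightarrow> bool"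
  where "algebra_iso_onto_product sc \<phi> S u T v \<longleftrightarrow>
    subalgebra sc S \<and> is_unit_of u S \<and> subalgebra sc T \<and> is_unit_of v T \<and>
    Vector_Spaces.linear sc (module_prod.scale sc sc) \<phi> \<and>
    bij_betw \<phi> UNIV (S \<times> T) \<and>
    (\<forall>a b. \<phi> (a * b) = (fst (\<phi> a) * fst (\<phi> b), snd (\<phi> a) * snd (\<phi> b))) \<and>
    \<phi> 1 = (u, v)"

end

theory Submission
  imports Defs
begin

text \<open>
  Write \<open>h\<close> for \<open>p\<^sub>g \<cdot> 1\<close>. Everything follows from the fact that \<open>v = 2 h\<close> is a central idempotent:
  the algebra splits as \<open>A = uA \<times> vA\<close> with \<open>u = 1 - v\<close>, and these two factors turn out to be
  \<open>B = A\<^sub>0 \<oplus> A\<^sub>1\<close> and \<open>A\<^sub>1\<^sub>/\<^sub>2\<close>.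

  Since \<open>p\<^sub>e = id - p\<^sub>g\<close>, the operators \<open>p\<^sub>e\<close> and \<open>p\<^sub>g\<close> commute. The axioms of a symmetric partial
  action evaluate the two compositions as \<open>h (p\<^sub>g \<cdot> a)\<close> and \<open>h (p\<^sub>e \<cdot> a)\<close>, or with \<open>h\<close> on the right.
  So \<open>h\<close> does not distinguish the two parts of \<open>a\<close>, that is \<open>h a = 2 h (p\<^sub>g \<cdot> a)\<close>, and likewise on
  the right. Because \<open>h (p\<^sub>g \<cdot> a) = (p\<^sub>g \<cdot> a) h\<close>, the element \<open>h\<close> is central
  (\<open>v_central\<close>), and \<open>a = 1\<close> gives \<open>h = 2 h\<^sup>2\<close>, so \<open>v\<close> is idempotent (\<open>v_idem\<close>).

  The remaining case of the axioms becomes \<open>p\<^sub>g \<cdot> (p\<^sub>g \<cdot> a) = p\<^sub>g \<cdot> a - v a / 4\<close> (\<open>p1_p1\<close>). On an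
  eigenvector with eigenvalue \<open>j\<close> it reads \<open>j (1 - j) a = v a / 4\<close>, which gives \<open>v a = 0\<close> for
  \<open>j = 0, 1\<close> and \<open>v a = a\<close> for \<open>j = 1/2\<close>. Conversely, \<open>p\<^sub>g\<close> is idempotent on \<open>{a. v a = 0}\<close>,
  which therefore is \<open>A\<^sub>0 \<oplus> A\<^sub>1\<close> (\<open>B_iff\<close>), and the product rule shows that \<open>p\<^sub>g\<close> halves every
  element of \<open>vA\<close> (\<open>component_half_iff\<close>). With these descriptions of \<open>B\<close> and \<open>A\<^sub>1\<^sub>/\<^sub>2\<close>, the claims
  are the usual ones on a central idempotent; the grading of \<open>B\<close> is the product rule for
  \<open>p\<^sub>g\<close>.
\<close>

section \<open>Direct sums\<close>

text \<open>
  The operators \<open>P i\<close> are the projections of the decomposition; taken together, they are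
  the inverse of the summation map. Both direct sums below come with explicit projections.
\<close>

lemma internal_direct_sum_by_projections:
  fixes sc :: "'k::field \<Rightarrow> 'a::ab_group_add \<Rightarrow> 'a"
  assumes fin: "finite I"
    and subspace: "\<And>i. i \<in> I \<Longrightarrow> module.subspace sc (V i)"
    and sums: "\<And>f. f \<in> Pi\<^sub>E I V \<Longrightarrow> (\<Sum>i\<in>I. f i) \<in> S"
    and additive: "\<And>i a b. i \<in> I \<Longrightarrow> P i (a + b) = P i a + P i b"
    and range: "\<And>i a. i \<in> I \<Longrightarrow> a \<in> S \<Longrightarrow> P i a \<in> V i"
    and complete: "\<And>a. a \<in> S \<Longrightarrow> (\<Sum>i\<in>I. P i a) = a"
    and delta: "\<And>i j a. i \<in> I \<Longrightarrow> j \<in> I \<Longrightarrow> a \<in> V j \<Longrightarrow> P i a = (if i = j then a else 0)"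
  shows "internal_direct_sum sc I V S"
proof -
  have P_sum: "P i (\<Sum>j\<in>I. f j) = f i" if "i \<in> I" "f \<in> Pi\<^sub>E I V" for i f
  proof -
    have "P i 0 = 0"
      using additive[OF \<open>i \<in> I\<close>, of 0 0] by simp
    then have "P i (\<Sum>j\<in>I. f j) = (\<Sum>j\<in>I. P i (f j))"
      using additive[OF \<open>i \<in> I\<close>] sum_comp_morphism[of "P i" f I] by (simp add: o_def)
    also have "\<dots> = (\<Sum>j\<in>I. if i = j then f j else 0)"
      using that by (intro sum.cong refl delta) auto
    finally show ?thesis
      using fin that by simp
  qed
  have "bij_betw (\<lambda>f. \<Sum>i\<in>I. f i) (Pi\<^sub>E I V) S"
  proof (rule bij_betw_byWitness)
    let ?Q = "\<lambda>a. restrict (\<lambda>i. P i a) I"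
    show "\<forall>f\<in>Pi\<^sub>E I V. ?Q (\<Sum>i\<in>I. f i) = f"
    proof
      fix f assume f: "f \<in> Pi\<^sub>E I V"
      show "?Q (\<Sum>i\<in>I. f i) = f"
        using P_sum[OF _ f] PiE_arb[OF f] by (auto simp: restrict_def fun_eq_iff)
    qed
    show "\<forall>a\<in>S. (\<Sum>i\<in>I. ?Q a i) = a"
      using complete by simp
    show "(\<lambda>f. \<Sum>i\<in>I. f i) ` Pi\<^sub>E I V \<subseteq> S"
      using sums by auto
    show "?Q ` S \<subseteq> Pi\<^sub>E I V"
      using range by auto
  qed
  with subspace show ?thesis
    unfolding internal_direct_sum_def by blast
qed

section \<open>The central idempotent\<close>

lemma two_neq_zero_if_CHAR_neq_2:
  assumes "CHAR('k::field) \<noteq> 2"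
  shows "(2::'k) \<noteq> 0"
proof
  assume "(2::'k) = 0"
  then have "of_nat 2 = (0::'k)"
    by simp
  then have "CHAR('k) dvd 2"
    by (simp only: of_nat_eq_0_iff_char_dvd)
  then have "CHAR('k) \<le> 2" "CHAR('k) \<noteq> 0"
    by (simp add: dvd_imp_le) (metis \<open>CHAR('k) dvd 2\<close> dvd_0_left_iff zero_neq_numeral)
  moreover have "CHAR('k) \<noteq> 1"
    using CHAR_not_1 by simp
  ultimately show False
    using assms by linarith
qed

lemma UNIV_bit: "(UNIV::bit set) = {0, 1}"
  by auto

locale partially_Z2_graded_algebra = partially_graded_algebra sc p
  for sc :: "'k::field \<Rightarrow> 'a::{ring, monoid_mult} \<Rightarrow> 'a"
    and p :: "bit \<Rightarrow> 'a \<Rightarrow> 'a" +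
  assumes char_not_2: "CHAR('k) \<noteq> 2"
begin

lemma two_nonzero: "(2::'k) \<noteq> 0"
  using char_not_2 by (rule two_neq_zero_if_CHAR_neq_2)

lemma four_nonzero: "(4::'k) \<noteq> 0"
proof -
  have "(4::'k) = 2 * 2"
    by simp
  then show ?thesis
    using two_nonzero by (metis mult_eq_0_iff)
qed

lemma p_add: "p x (a + b) = p x a + p x b"
  and p_scale: "p x (sc c a) = sc c (p x a)"
  using p_linear[of x] unfolding Vector_Spaces.linear_iff by auto

lemma p0: "p 0 a = a - p 1 a"
  using p_sum[of a] by (simp add: UNIV_bit algebra_simps)

lemma p1_mult: "p 1 (a * b) = p 1 a * p 0 b + p 0 a * p 1 b"
  using p_mult[of 1 a b] by (simp add: UNIV_bit)

lemma p1_diff: "p 1 (a - b) = p 1 a - p 1 b"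
  using p_add[of 1 "a - b" b] by simp

text \<open>The units of the two factors \<open>A\<^sub>1\<^sub>/\<^sub>2\<close> and \<open>B\<close>.\<close>

definition v :: 'a where "v = sc 2 (p 1 1)"
definition u :: 'a where "u = 1 - v"

text \<open>
  The two orders of composing \<open>p 0\<close> and \<open>p 1\<close> agree because \<open>p 0 + p 1 = id\<close>. By the left
  (respectively right) form of the composition axiom, \<open>p 1 1\<close> then has the same product with
  \<open>p 0 a\<close> as with \<open>p 1 a\<close>, so its product with \<open>a\<close> is twice that value.
\<close>

lemma unit_half_mult: "p 1 1 * a = sc 2 (p 1 1 * p 1 a)"
  and mult_unit_half: "a * p 1 1 = sc 2 (p 1 a * p 1 1)"
proof -
  have comm: "p 1 (p 0 a) = p 0 (p 1 a)"
    by (simp add: p0 p1_diff)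
  then have "p 1 1 * p 0 a = p 1 1 * p 1 a"
    using p_p_left[of 1 0 a] p_p_left[of 0 1 a] by simp
  then show "p 1 1 * a = sc 2 (p 1 1 * p 1 a)"
    using scale_left_distrib[of 1 1 "p 1 1 * p 1 a"] by (simp add: p0 algebra_simps)
  have "p 0 a * p 1 1 = p 1 a * p 1 1"
    using comm p_p_right[of 1 0 a] p_p_right[of 0 1 a] by simp
  then show "a * p 1 1 = sc 2 (p 1 a * p 1 1)"
    using scale_left_distrib[of 1 1 "p 1 a * p 1 1"] by (simp add: p0 algebra_simps)
qed

text \<open>
  The left and right forms of the composition axiom for \<open>p 0 (p 1 a)\<close> say that \<open>p 1 1\<close> commutes
  with \<open>p 1 a\<close>; the preceding lemma transfers this to \<open>a\<close> itself.
\<close>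

lemma v_central: "v * a = a * v"
proof -
  have "p 1 1 * p 1 a = p 1 a * p 1 1"
    using p_p_left[of 0 1 a] p_p_right[of 0 1 a] by simp
  then have "p 1 1 * a = a * p 1 1"
    by (simp only: unit_half_mult[of a] mult_unit_half[of a])
  then show ?thesis
    by (simp add: v_def scale_mult_left[symmetric] scale_mult_right[symmetric])
qed

lemma v_mult: "v * a = sc 2 (v * p 1 a)"
  using unit_half_mult[of a] by (simp add: v_def scale_mult_left[symmetric])

lemma half_v: "sc (1/2) v = p 1 1"
  using two_nonzero by (simp add: v_def)

lemma v_idem: "v * v = v"
  using v_mult[of 1] scale_mult_right[of 2 v "p 1 1"] by (metis v_def mult_1_right)

text \<open>
  Multiplied by \<open>u\<close>, this says that \<open>p 1\<close> is idempotent on \<open>uA\<close>; on eigenvectors it determines how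
  \<open>v\<close> acts in terms of the eigenvalue.
\<close>

lemma p1_p1: "p 1 (p 1 a) = p 1 a - sc (1/4) (v * a)"
proof -
  have "p 1 (p 1 a) = p 0 1 * p 1 a"
    using p_p_left[of 1 1 a] by simp
  also have "\<dots> = p 1 a - sc (1/2) (v * p 1 a)"
    by (simp add: p0[of 1] left_diff_distrib scale_mult_left half_v)
  also have "sc (1/2) (v * p 1 a) = sc (1/4) (v * a)"
    using two_nonzero four_nonzero by (subst v_mult[of a]) simp
  finally show ?thesis .
qed

lemma p1_v: "p 1 v = sc (1/2) v"
proof -
  have "p 1 (p 1 1) = sc (1/2) v - sc (1/4) v"
    using p1_p1[of 1] by (simp add: half_v)
  also have "\<dots> = sc (1/4) v"
    using two_nonzero four_nonzero by (simp add: scale_left_diff_distrib[symmetric] divide_simps)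
  finally show ?thesis
    using two_nonzero four_nonzero by (simp add: v_def p_scale)
qed

text \<open>
  Both \<open>p 0 v\<close> and \<open>p 1 v\<close> are \<open>v/2\<close>, so the product rule for \<open>p 1 (v * a)\<close> recombines
  \<open>p 0 a\<close> and \<open>p 1 a\<close> to \<open>a\<close>.
\<close>

lemma p1_v_mult: "p 1 (v * a) = sc (1/2) (v * a)"
proof -
  have "p 0 v = sc (1/2) v"
    using two_nonzero scale_left_diff_distrib[of 1 "1/2" v]
    by (simp add: p0 p1_v diff_divide_eq_iff)
  then show ?thesis
    by (simp add: p1_mult p1_v p0[of a] right_diff_distrib scale_mult_left)
qed

section \<open>The eigenspaces\<close>

lemma component_iff: "a \<in> component sc p j \<longleftrightarrow> p 1 a = sc j a"
  by (simp add: component_def)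

lemma subspace_component: "module.subspace sc (component sc p j)"
  by (rule subspaceI)
    (use p_scale[of 1 0 0] in
      \<open>auto simp: component_iff p_add p_scale scale_right_distrib scale_left_commute\<close>)

lemma v_mult_component:
  assumes "a \<in> component sc p j"
  shows "sc (j * (1 - j)) a = sc (1/4) (v * a)"
  using assms p1_p1[of a]
  by (simp add: component_iff p_scale algebra_simps)

lemma component_half_iff: "a \<in> component sc p (1/2) \<longleftrightarrow> v * a = a"
proof
  assume "a \<in> component sc p (1/2)"
  then have "sc (1/4) a = sc (1/4) (v * a)"
    using v_mult_component[of a "1/2"] two_nonzero by (simp add: diff_divide_eq_iff)
  then show "v * a = a"
    using four_nonzero by simp
next
  assume "v * a = a"
  then show "a \<in> component sc p (1/2)"
    using p1_v_mult[of a] by (simp add: component_iff)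
qed

definition B :: "'a set"
  where "B = sum_of_subspaces (component sc p 0) (component sc p 1)"

lemma v_mult_component_01:
  assumes "a \<in> component sc p 0 \<or> a \<in> component sc p 1"
  shows "v * a = 0"
  using assms v_mult_component[of a 0] v_mult_component[of a 1] four_nonzero by auto

lemma p_in_component:
  assumes "v * a = 0"
  shows "p 0 a \<in> component sc p 0" "p 1 a \<in> component sc p 1"
  using assms by (simp_all add: component_iff p0 p1_diff p1_p1)

lemma B_iff: "a \<in> B \<longleftrightarrow> v * a = 0"
proof
  assume "a \<in> B"
  then show "v * a = 0"
    by (auto simp: B_def sum_of_subspaces_def distrib_left v_mult_component_01)
next
  assume "v * a = 0"
  moreover have "a = p 0 a + p 1 a"
    by (simp add: p0)
  ultimately show "a \<in> B"
    using p_in_component unfolding B_def sum_of_subspaces_def by blast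
qed

section \<open>The decomposition of the algebra\<close>

lemma subalgebra_B: "subalgebra sc B"
  unfolding subalgebra_def
proof (intro conjI ballI)
  show "module.subspace sc B"
    by (rule subspaceI)
      (auto simp: B_iff distrib_left scale_mult_right[symmetric])
next
  fix a b assume "a \<in> B" "b \<in> B"
  then show "a * b \<in> B"
    by (simp add: B_iff mult.assoc[symmetric])
qed

lemma ideal_component_half: "algebra_ideal sc (component sc p (1/2))"
  unfolding algebra_ideal_def
proof (intro conjI allI ballI)
  fix a b assume "b \<in> component sc p (1/2)"
  then have b: "v * b = b"
    by (simp add: component_half_iff)
  have "v * (a * b) = a * (v * b)"
    by (metis mult.assoc v_central)
  then show "a * b \<in> component sc p (1/2)"
    using b by (simp add: component_half_iff)
  show "b * a \<in> component sc p (1/2)"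
    using b by (simp add: component_half_iff mult.assoc[symmetric])
qed (rule subspace_component)

text \<open>Equivalently, by \<open>B_iff\<close>, the subspace \<open>uA\<close> is contained in \<open>B\<close>.\<close>

lemma v_annihilates_u_mult: "v * (u * a) = 0"
proof -
  have "v * u = 0"
    by (simp add: u_def right_diff_distrib v_idem)
  then show ?thesis
    by (simp add: mult.assoc[symmetric])
qed

lemma u_mult: "u * a = a - v * a"
  by (simp add: u_def left_diff_distrib)

text \<open>
  The projection onto \<open>A\<^sub>1\<^sub>/\<^sub>2\<close> is multiplication by \<open>v\<close>; those onto \<open>A\<^sub>0\<close> and \<open>A\<^sub>1\<close> first cut down to
  \<open>uA\<close>, where \<open>p 0\<close> and \<open>p 1\<close> are complementary idempotents.
\<close>

lemma direct_sum_components: "internal_direct_sum sc {0, 1, 1/2} (component sc p) UNIV"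
proof -
  have "(1::'k) \<noteq> 2"
    by (metis add_cancel_right_right one_add_one zero_neq_one)
  then have distinct: "(1/2::'k) \<noteq> 0" "(1/2::'k) \<noteq> 1"
    using two_nonzero by (auto simp: divide_simps)
  define P where "P = (\<lambda>j::'k. if j = 0 then (\<lambda>a. p 0 (u * a))
      else if j = 1 then (\<lambda>a. p 1 (u * a)) else (\<lambda>a. v * a))"
  have P: "P 0 a = p 0 (u * a)" "P 1 a = p 1 (u * a)" "P (1/2) a = v * a" for a
    using distinct by (auto simp: P_def)
  show ?thesis
  proof (rule internal_direct_sum_by_projections[where P = P])
    show "P i (a + b) = P i a + P i b" for i a b
      by (simp add: P_def distrib_left p_add)
    show "P i a \<in> component sc p i" if "i \<in> {0, 1, 1/2}" for i a
      using that p_in_component[OF v_annihilates_u_mult[of a]]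
      by safe (simp_all add: P component_half_iff v_idem mult.assoc[symmetric])
    show "(\<Sum>i\<in>{0, 1, 1/2}. P i a) = a" for a
      using distinct[symmetric] by (simp add: P p0 u_mult)
    show "P i a = (if i = j then a else 0)"
      if "i \<in> {0, 1, 1/2}" "j \<in> {0, 1, 1/2}" "a \<in> component sc p j" for i j a
    proof (cases "j = 1/2")
      case True
      then have "v * a = a"
        using that(3) by (simp only: component_half_iff)
      moreover have "p x 0 = 0" for x
        using p_scale[of x 0 0] by simp
      ultimately show ?thesis
        using that(1) distinct unfolding True by safe (simp_all add: P u_mult)
    next
      case False
      then have "v * a = 0"
        using that v_mult_component_01 by auto
      then show ?thesis
        using that False distinct by safe (simp_all add: P u_mult p0 component_iff)
    qed
  qed (simp_all add: subspace_component)
qed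

text \<open>
  On \<open>A\<^sub>0\<close> the operator \<open>p 1\<close> is zero and \<open>p 0\<close> is the identity, on \<open>A\<^sub>1\<close> the other way round. So
  \<open>p 0\<close> and \<open>p 1\<close> themselves are the projections of \<open>B\<close>, and in the product rule for
  \<open>p 1 (a * b)\<close> exactly the mixed products survive.
\<close>

lemma graded_B: "graded_by sc B (case_bit (component sc p 0) (component sc p 1))"
  unfolding graded_by_def
proof (intro conjI allI ballI)
  let ?V = "case_bit (component sc p 0) (component sc p 1)"
  show "internal_direct_sum sc UNIV ?V B"
  proof (rule internal_direct_sum_by_projections[where P = p])
    show "module.subspace sc (?V i)" for i
      by (cases i) (simp_all add: subspace_component)
    show "(\<Sum>i\<in>UNIV. f i) \<in> B" if "f \<in> Pi\<^sub>E UNIV ?V" for f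
    proof -
      have "f 0 \<in> ?V 0" "f 1 \<in> ?V 1"
        using that by blast+
      then show ?thesis
        by (auto simp: UNIV_bit B_def sum_of_subspaces_def)
    qed
    show "p i a \<in> ?V i" if "a \<in> B" for i a
      using that by (cases i) (simp_all add: B_iff p_in_component)
    show "p i a = (if i = j then a else 0)" if "a \<in> ?V j" for i j a
      using that by (cases i; cases j) (auto simp: component_iff p0)
  qed (simp_all add: p_add p_sum)
  show "a * b \<in> ?V (x + y)" if "a \<in> ?V x" "b \<in> ?V y" for x y a b
    using that by (cases x; cases y) (simp_all add: component_iff p1_mult p0)
qed

text \<open>
  Multiplication by a central idempotent \<open>w\<close> is multiplicative, since \<open>w a b = w a w b\<close>; here it
  is applied to \<open>u\<close> and to \<open>v\<close>. The inverse isomorphism is addition, because \<open>u + v = 1\<close>.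
\<close>

lemma iso_onto_product:
  "algebra_iso_onto_product sc (\<lambda>a. (u * a, v * a)) B u (component sc p (1/2)) v"
  unfolding algebra_iso_onto_product_def
proof (intro conjI allI)
  have u_central: "u * a = a * u" for a
    using v_central[of a] by (simp add: u_def algebra_simps)
  have u_idem: "u * u = u"
    using v_annihilates_u_mult[of 1] by (simp add: u_mult)
  show "subalgebra sc B"
    by (rule subalgebra_B)
  have "u * a = a" "a * u = a" if "a \<in> B" for a
    using that u_central[of a] by (simp_all add: B_iff u_mult)
  then show "is_unit_of u B"
    using v_annihilates_u_mult[of 1] by (simp add: is_unit_of_def B_iff)
  show "subalgebra sc (component sc p (1/2))"
    using ideal_component_half by (auto simp: subalgebra_def algebra_ideal_def)
  have "v * a = a" "a * v = a" if "a \<in> component sc p (1/2)" for a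
    using that v_central[of a] by (simp_all add: component_half_iff)
  then show "is_unit_of v (component sc p (1/2))"
    using component_half_iff v_idem unfolding is_unit_of_def by blast
  interpret prod: vector_space_prod sc sc
    by unfold_locales
  show "Vector_Spaces.linear sc (module_prod.scale sc sc) (\<lambda>a. (u * a, v * a))"
    by (simp add: Vector_Spaces.linear_iff vector_space_axioms prod.p.vector_space_axioms
        prod.scale_prod distrib_left scale_mult_right)
  show "bij_betw (\<lambda>a. (u * a, v * a)) UNIV (B \<times> component sc p (1/2))"
  proof (rule bij_betw_byWitness[where f' = "\<lambda>(a, b). a + b"])
    have v_v: "v * (v * a) = v * a" for a
      by (simp add: mult.assoc[symmetric] v_idem)
    show "\<forall>a\<in>UNIV. (case (u * a, v * a) of (a, b) \<Rightarrow> a + b) = a"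
      by (simp add: u_mult)
    show "\<forall>c\<in>B \<times> component sc p (1/2).
        (u * (case c of (a, b) \<Rightarrow> a + b), v * (case c of (a, b) \<Rightarrow> a + b)) = c"
      by (auto simp: B_iff component_half_iff u_mult distrib_left)
    show "range (\<lambda>a. (u * a, v * a)) \<subseteq> B \<times> component sc p (1/2)"
      by (auto simp: B_iff component_half_iff v_annihilates_u_mult v_v)
    show "(\<lambda>(a, b). a + b) ` (B \<times> component sc p (1/2)) \<subseteq> UNIV"
      by simp
  qed
  show "(u * (a * b), v * (a * b)) =
      (fst (u * a, v * a) * fst (u * b, v * b), snd (u * a, v * a) * snd (u * b, v * b))" for a b
  proof -
    have "w * (a * b) = w * a * (w * b)" if "w * w = w" "\<And>c. w * c = c * w" for w
    proof -
      have "w * a * (w * b) = w * (a * w) * b"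
        by (simp only: mult.assoc)
      also have "\<dots> = w * w * a * b"
        by (simp only: that(2)[of a, symmetric] mult.assoc)
      finally show ?thesis
        using that(1) by (simp add: mult.assoc)
    qed
    then show ?thesis
      using v_idem v_central u_idem u_central by (metis fst_conv snd_conv)
  qed
  show "(u * 1, v * 1) = (u, v)"
    by simp
qed

end

theorem theorem6p8:
  fixes sc :: "'k::field \<Rightarrow> 'a::{ring, monoid_mult} \<Rightarrow> 'a"
    and p :: "bit \<Rightarrow> 'a \<Rightarrow> 'a"
  assumes "CHAR('k) \<noteq> 2"
    and "partially_graded_algebra sc p"
  shows "let A = component sc p;
             B = sum_of_subspaces (A 0) (A 1)
         in internal_direct_sum sc {0, 1, 1/2} A UNIV \<and>
            subalgebra sc B \<and>
            graded_by sc B (case_bit (A 0) (A 1)) \<and>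
            algebra_ideal sc (A (1/2)) \<and>
            (\<exists>u v. 1 = u + v \<and> u \<in> A 0 \<and> v \<in> A (1/2) \<and>
                   u * u = u \<and> v * v = v \<and> u * v = 0 \<and> v * u = 0 \<and>
                   (\<forall>a. u * a * v = 0 \<and> v * a * u = 0) \<and>
                   (\<exists>\<phi>. algebra_iso_onto_product sc \<phi> B u (A (1/2)) v))"
proof -
  interpret partially_Z2_graded_algebra sc p
    using assms by (simp add: partially_Z2_graded_algebra_def partially_Z2_graded_algebra_axioms_def)
  have "1 = u + v"
    by (simp add: u_def)
  moreover have "u \<in> component sc p 0"
    using half_v by (simp add: u_def component_iff p1_diff p1_v)
  moreover have "v \<in> component sc p (1/2)"
    by (simp add: component_half_iff v_idem)
  moreover have "u * a * v = 0" "v * a * u = 0" for a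
    using v_central[of a] v_idem
    by (simp_all add: u_def left_diff_distrib right_diff_distrib mult.assoc)
  moreover have "u * v = 0" "v * u = 0" "u * u = u"
    by (simp_all add: u_def algebra_simps v_idem)
  moreover note v_idem iso_onto_product
  ultimately show ?thesis
    using direct_sum_components subalgebra_B graded_B ideal_component_half
    unfolding Let_def B_def by blast
qed

end
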